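(* Let $X$ and $Y$ be real Banach spaces, let $x_0\in S_X$, $y_0\in S_Y$, and suppose that $x_0\otimes y_0$ is a Namioka point of $B_{\mathcal{L}(X,Y^* )^*}$. Then $x_0$ is a Namioka point of $B_{X^{**}}$ and $y_0$ is a Namioka point of $B_{Y^{**}}$.
   Context: $B_Z$ and $S_Z$ denote the closed unit ball and unit sphere of a Banach space $Z$; $Z$ is regarded as canonically embedded in $Z^{**}$. A point $z_0^*\in B_{Z^*}$ is a Namioka point of $B_{Z^*}$ if the identity map $(B_{Z^*},\text{weak}^* )\to(B_{Z^*},\text{weak})$ is continuous at $z_0^*$, where the weak$^*$-topology on $Z^*$ is induced by $Z$ and the weak topology by $Z^{**}$. $\mathcal{L}(X,Y^* )$ is the space of bounded linear operators from $X$ to $Y^*$, identified isometrically with $(X\hat{\otimes}_\pi Y)^*$, the dual of the projective tensor product, via $T(x\otimes y)=(Tx)(y)$; thus $\mathcal{L}(X,Y^* )^*=(X\hat{\otimes}_\pi Y)^{**}$, with weak$^*$-topology induced by $\mathcal{L}(X,Y^* )$, and $x_0\otimes y_0$ is viewed in it through the canonical embedding, i.e. as the functional $T\mapsto (Tx_0)(y_0)$. *)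

theory Defs
  imports "HOL-Analysis.Analysis"
begin

definition bidual_embed :: "'a::real_normed_vector \<Rightarrow> (('a \<Rightarrow>\<^sub>L real) \<Rightarrow>\<^sub>L real)"
  where "bidual_embed x = Blinfun (\<lambda>f. blinfun_apply f x)"

lemma bidual_embed_apply [simp]: "blinfun_apply (bidual_embed x) f = blinfun_apply f x"
  unfolding bidual_embed_def
  by (simp add: bounded_linear_Blinfun_apply[OF blinfun.bounded_linear_left])

text \<open>
  The dual of the projective tensor product of \<open>X\<close> and \<open>Y\<close> is identified isometrically with the
  space of bounded operators from \<open>X\<close> to the dual of \<open>Y\<close>. Under this identification the
  canonical image of the elementary tensor of \<open>x\<close> and \<open>y\<close> in the bidual of the projective tensor
  product is the following functional on operators.
\<close>

definition elem_tensor ::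
  "'a::real_normed_vector \<Rightarrow> 'b::real_normed_vector \<Rightarrow> (('a \<Rightarrow>\<^sub>L ('b \<Rightarrow>\<^sub>L real)) \<Rightarrow>\<^sub>L real)"
  where "elem_tensor x y = Blinfun (\<lambda>T. blinfun_apply (blinfun_apply T x) y)"

lemma elem_tensor_apply [simp]:
  "blinfun_apply (elem_tensor x y) T = blinfun_apply (blinfun_apply T x) y"
  unfolding elem_tensor_def
  by (subst bounded_linear_Blinfun_apply)
    (auto intro: bounded_linear_compose[OF blinfun.bounded_linear_left blinfun.bounded_linear_left])

text \<open>For scalar-valued operators, pointwise convergence is weak* convergence.\<close>

abbreviation weak_star_topology :: "('a::real_normed_vector \<Rightarrow>\<^sub>L real) topology"
  where "weak_star_topology \<equiv> strong_operator_topology"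

text \<open>
  The coarsest topology making every bounded linear functional continuous; \<open>euclidean\<close> is here
  the product topology on real-valued functions on the dual.
\<close>

definition weak_topology :: "'a::real_normed_vector topology"
  where "weak_topology =
    pullback_topology UNIV (\<lambda>z (f :: 'a \<Rightarrow>\<^sub>L real). blinfun_apply f z) euclidean"

lemma topspace_weak_topology [simp]: "topspace weak_topology = UNIV"
  by (simp add: weak_topology_def topspace_pullback_topology)

text \<open>
  The argument is a functional on \<open>Z = 'a\<close>: the weak* topology on the dual of \<open>Z\<close> is induced by
  \<open>Z\<close>, the weak one by the bidual of \<open>Z\<close>.
\<close>

definition namioka_point :: "('a::banach \<Rightarrow>\<^sub>L real) \<Rightarrow> bool"
  where "namioka_point z \<longleftrightarrow>
    topcontinuous_at
      (subtopology weak_star_topology (cball 0 1)) (subtopology weak_topology (cball 0 1)) id z"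

end

theory Submission
  imports Defs
begin

text \<open>
  Write \<open>Z\<close> for the space of operators from \<open>X\<close> to the dual of \<open>Y\<close>. Fixing \<open>y\<^sub>0\<close> turns an
  operator \<open>T\<close> into the functional \<open>S T = (x \<mapsto> T x y\<^sub>0)\<close> on \<open>X\<close>, and \<open>S\<close> is a contraction from
  \<open>Z\<close> onto the dual of \<open>X\<close>. If \<open>g\<close> is a functional on \<open>Y\<close> with \<open>g y\<^sub>0 = 1\<close>, then sending \<open>f\<close> to
  the rank-one operator \<open>x \<mapsto> f x \<cdot> g\<close> is a bounded right inverse \<open>R\<close> of \<open>S\<close>. Dually, the adjoint
  of \<open>S\<close> embeds the bidual of \<open>X\<close> into the dual of \<open>Z\<close>: it is weak*-to-weak* continuous, maps the
  unit ball into the unit ball and takes \<open>x\<^sub>0\<close> to the elementary tensor of \<open>x\<^sub>0\<close> and \<open>y\<^sub>0\<close>. The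
  adjoint of \<open>R\<close> undoes this embedding and, like every bounded operator, is weak-to-weak
  continuous. On the unit ball of the bidual of \<open>X\<close>, the identity factors as

    (weak*) \<open>\<longrightarrow>\<close> (weak*) \<open>\<longrightarrow>\<close> (weak) \<open>\<longrightarrow>\<close> (weak),

  the adjoint of \<open>S\<close>, the identity on the unit ball of the dual of \<open>Z\<close>, and the adjoint of \<open>R\<close>.
  The middle map is continuous at the elementary tensor by hypothesis, so the composition is
  continuous at \<open>x\<^sub>0\<close>. This transfer principle is \<open>namioka_point_retract\<close>; it applies to \<open>y\<^sub>0\<close> in
  the same way, with evaluation at \<open>x\<^sub>0\<close> as the contraction.

  The functional \<open>g\<close> comes from the Hahn--Banach theorem, proved here in the form that every
  sublinear functional dominates a linear one: a minimal sublinear functional is linear.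
\<close>

section \<open>Sublinear functionals and the Hahn--Banach theorem\<close>

definition sublinear :: "('a::real_vector \<Rightarrow> real) \<Rightarrow> bool"
  where "sublinear p \<longleftrightarrow>
    (\<forall>x y. p (x + y) \<le> p x + p y) \<and> (\<forall>c x. 0 \<le> c \<longrightarrow> p (c *\<^sub>R x) = c * p x)"

lemma sublinear_add: "sublinear p \<Longrightarrow> p (x + y) \<le> p x + p y"
  and sublinear_scaleR: "sublinear p \<Longrightarrow> 0 \<le> c \<Longrightarrow> p (c *\<^sub>R x) = c * p x"
  by (auto simp: sublinear_def)

lemma sublinear_zero: "sublinear p \<Longrightarrow> p 0 = 0"
  using sublinear_scaleR[of p 0 0] by simp

lemma sublinear_uminus: "sublinear p \<Longrightarrow> - p (- x) \<le> p x"
  using sublinear_add[of p x "- x"] sublinear_zero[of p] by simp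

text \<open>
  For \<open>c > 0\<close>, the inequality for \<open>c\<close> and the one for \<open>1 / c\<close> give equality; for \<open>c = 0\<close>,
  subadditivity supplies \<open>0 \<le> p 0\<close>.
\<close>

lemma sublinearI:
  assumes add: "\<And>x y. p (x + y) \<le> p x + p y"
    and scale: "\<And>c x. 0 \<le> c \<Longrightarrow> p (c *\<^sub>R x) \<le> c * p x"
  shows "sublinear p"
proof -
  have "p (c *\<^sub>R x) = c * p x" if "0 \<le> c" for c x
  proof (cases "c = 0")
    case True
    have "p 0 \<le> 0" using scale[of 0 0] by simp
    moreover have "0 \<le> p 0" using add[of 0 0] by simp
    ultimately show ?thesis using True by simp
  next
    case False
    with that have "0 < c" by simp
    then have "p x \<le> (1 / c) * p (c *\<^sub>R x)"
      using scale[of "1 / c" "c *\<^sub>R x"] by simp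
    then have "c * p x \<le> p (c *\<^sub>R x)"
      using \<open>0 < c\<close> by (simp add: field_simps)
    with scale[OF that, of x] show ?thesis by simp
  qed
  with add show ?thesis by (auto simp: sublinear_def)
qed

text \<open>
  The two infima needed below, over a chain of sublinear functionals and over a ray in the space,
  both satisfy these directedness conditions. The conditions relate different members of the
  family because the functions indexed by the points of a ray are not individually sublinear.
\<close>

lemma sublinear_INF:
  fixes F :: "'i \<Rightarrow> 'a::real_vector \<Rightarrow> real"
  assumes ne: "I \<noteq> {}"
    and bdd: "\<And>x. bdd_below ((\<lambda>i. F i x) ` I)"
    and add: "\<And>i j x y. i \<in> I \<Longrightarrow> j \<in> I \<Longrightarrow> \<exists>k\<in>I. F k (x + y) \<le> F i x + F j y"
    and scale: "\<And>i c x. i \<in> I \<Longrightarrow> 0 \<le> c \<Longrightarrow> \<exists>k\<in>I. F k (c *\<^sub>R x) \<le> c * F i x"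
  shows "sublinear (\<lambda>x. INF i\<in>I. F i x)"
proof (rule sublinearI)
  let ?q = "\<lambda>x. INF i\<in>I. F i x"
  have lower: "?q x \<le> F i x" if "i \<in> I" for i x
    using cINF_lower[OF bdd that] .
  show "?q (x + y) \<le> ?q x + ?q y" for x y
  proof -
    have "?q (x + y) - F i x \<le> ?q y" if i: "i \<in> I" for i
    proof (rule cINF_greatest[OF ne])
      fix j assume "j \<in> I"
      with add[OF i this, of x y] lower[of _ "x + y"]
      show "?q (x + y) - F i x \<le> F j y" by fastforce
    qed
    then have "?q (x + y) - ?q y \<le> ?q x"
      by (intro cINF_greatest[OF ne]) (fastforce simp: algebra_simps)
    then show ?thesis by simp
  qed
  show "?q (c *\<^sub>R x) \<le> c * ?q x" if "0 \<le> c" for c x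
  proof -
    have *: "?q (c *\<^sub>R x) \<le> c * F i x" if "i \<in> I" for i
      using scale[OF that \<open>0 \<le> c\<close>, of x] lower[of _ "c *\<^sub>R x"] by fastforce
    show ?thesis
    proof (cases "c = 0")
      case True
      with * ne show ?thesis by auto
    next
      case False
      with \<open>0 \<le> c\<close> have "0 < c" by simp
      then have "?q (c *\<^sub>R x) / c \<le> ?q x"
        using * by (intro cINF_greatest[OF ne]) (simp add: field_simps)
      with \<open>0 < c\<close> show ?thesis by (simp add: field_simps)
    qed
  qed
qed

text \<open>
  A sublinear \<open>q\<close> can be lowered, by passing to the infimum of \<open>q (x + t y) - t q y\<close> over
  \<open>t \<ge> 0\<close>, until it is odd at \<open>y\<close>. This both forces minimal functionals to be linear and
  prescribes the value at one vector.
\<close>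

lemma sublinear_lower:
  assumes q: "sublinear q"
  obtains r where "sublinear r" "\<And>x. r x \<le> q x" "r (- y) \<le> - q y"
proof
  let ?F = "\<lambda>t x. q (x + t *\<^sub>R y) - t * q y"
  let ?r = "\<lambda>x. INF t\<in>{0..}. ?F t x"
  have bdd: "bdd_below ((\<lambda>t. ?F t x) ` {0..})" for x
  proof (rule bdd_belowI2)
    fix t :: real assume "t \<in> {0..}"
    then have "t * q y = q ((x + t *\<^sub>R y) + - x)"
      using sublinear_scaleR[OF q] by simp
    also have "\<dots> \<le> q (x + t *\<^sub>R y) + q (- x)"
      by (rule sublinear_add[OF q])
    finally show "- q (- x) \<le> ?F t x" by simp
  qed
  show "sublinear ?r"
  proof (rule sublinear_INF)
    show "{0::real..} \<noteq> {}" by auto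
    show "bdd_below ((\<lambda>t. ?F t x) ` {0..})" for x by (rule bdd)
  next
    fix s t :: real and x z assume "s \<in> {0..}" "t \<in> {0..}"
    moreover have "?F (s + t) (x + z) \<le> ?F s x + ?F t z"
      using sublinear_add[OF q, of "x + s *\<^sub>R y" "z + t *\<^sub>R y"]
      by (simp add: algebra_simps)
    ultimately show "\<exists>k\<in>{0..}. ?F k (x + z) \<le> ?F s x + ?F t z"
      by (intro bexI[of _ "s + t"]) auto
  next
    fix t c :: real and x assume "t \<in> {0..}" "0 \<le> c"
    moreover from this have "?F (c * t) (c *\<^sub>R x) \<le> c * ?F t x"
      using sublinear_scaleR[OF q, of c "x + t *\<^sub>R y"] by (simp add: algebra_simps)
    ultimately show "\<exists>k\<in>{0..}. ?F k (c *\<^sub>R x) \<le> c * ?F t x"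
      by (intro bexI[of _ "c * t"]) auto
  qed
  show "?r x \<le> q x" for x
    using cINF_lower[OF bdd, of 0 x] by simp
  show "?r (- y) \<le> - q y"
    using cINF_lower[OF bdd, of 1 "- y"] sublinear_zero[OF q] by simp
qed

theorem Hahn_Banach_sublinear:
  fixes p :: "'a::real_vector \<Rightarrow> real"
  assumes p: "sublinear p"
  obtains f where "linear f" "\<And>x. f x \<le> p x"
proof -
  define A where "A = {q. sublinear q \<and> q \<le> p}"
  have "\<exists>m\<in>A. \<forall>q\<in>A. m \<ge> q \<longrightarrow> q = m"
  proof (rule predicate_Zorn)
    show "partial_order_on A (relation_of (\<ge>) A)"
      by (rule partial_order_on_relation_ofI) auto
  next
    fix C assume C: "C \<in> Chains (relation_of (\<ge>) A)"
    have CA: "sublinear q" "q \<le> p" if "q \<in> C" for q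
      using C that by (auto simp: Chains_def relation_of_def A_def)
    have total: "q \<le> r \<or> r \<le> q" if "q \<in> C" "r \<in> C" for q r
      using C that by (auto simp: Chains_def relation_of_def)
    show "\<exists>u\<in>A. \<forall>a\<in>C. a \<ge> u"
    proof (cases "C = {}")
      case True
      with p show ?thesis by (auto simp: A_def)
    next
      case False
      let ?u = "\<lambda>x. INF q\<in>C. q x"
      have bdd: "bdd_below ((\<lambda>q. q x) ` C)" for x
      proof (rule bdd_belowI2)
        fix q assume "q \<in> C"
        from sublinear_uminus[OF CA(1)[OF this], of x] CA(2)[OF this]
        show "- p (- x) \<le> q x" by (auto simp: le_fun_def dest: spec[of _ "- x"])
      qed
      have lower: "?u \<le> q" if "q \<in> C" for q
        using cINF_lower[OF bdd that] by (auto simp: le_fun_def)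
      have "sublinear ?u"
      proof (rule sublinear_INF[OF False bdd])
        fix q r x y assume qr: "q \<in> C" "r \<in> C"
        \<comment> \<open>The smaller of the two members serves for both.\<close>
        define s where "s = (if q \<le> r then q else r)"
        have "s \<in> C" "s \<le> q" "s \<le> r"
          using qr total[OF qr] by (auto simp: s_def)
        moreover from this have "s (x + y) \<le> q x + r y"
          using sublinear_add[OF CA(1), of s x y] add_mono[of "s x" "q x" "s y" "r y"]
          by (simp add: le_fun_def)
        ultimately show "\<exists>s\<in>C. s (x + y) \<le> q x + r y" by (intro bexI[of _ s])
      next
        fix q c x assume "q \<in> C" "0 \<le> (c::real)"
        with sublinear_scaleR[OF CA(1)] show "\<exists>s\<in>C. s (c *\<^sub>R x) \<le> c * q x"
          by fastforce
      qed
      moreover have "?u \<le> p"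
        using False lower CA(2) order_trans by blast
      ultimately show ?thesis
        using lower by (auto simp: A_def)
    qed
  qed
  then obtain m where m: "sublinear m" "m \<le> p"
    and min: "\<And>q. sublinear q \<Longrightarrow> q \<le> m \<Longrightarrow> q = m"
    by (auto simp: A_def intro: order_trans)
  have odd: "m (- y) = - m y" for y
  proof -
    obtain r where "sublinear r" "\<And>x. r x \<le> m x" "r (- y) \<le> - m y"
      using sublinear_lower[OF m(1), of y] by metis
    with min[of r] have "m (- y) \<le> - m y" by (auto simp: le_fun_def)
    with sublinear_uminus[OF m(1), of y] show ?thesis by simp
  qed
  have "linear m"
  proof (rule linearI)
    fix x y
    from sublinear_add[OF m(1), of "x + y" "- y"] sublinear_add[OF m(1), of x y]
    show "m (x + y) = m x + m y" by (simp add: odd)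
  next
    fix c x
    show "m (c *\<^sub>R x) = c *\<^sub>R m x"
    proof (cases "0 \<le> c")
      case True
      with sublinear_scaleR[OF m(1)] show ?thesis by simp
    next
      case False
      with sublinear_scaleR[OF m(1), of "- c" x] odd[of "c *\<^sub>R x"] show ?thesis by simp
    qed
  qed
  with m(2) show thesis by (intro that) (auto simp: le_fun_def)
qed

text \<open>
  Lowering the norm at \<open>y\<close> before applying Hahn--Banach makes the dominated functional attain the
  norm of \<open>y\<close>.
\<close>

corollary norming_functional_exists:
  fixes y :: "'a::real_normed_vector"
  obtains g :: "'a \<Rightarrow>\<^sub>L real" where "blinfun_apply g y = norm y" "norm g \<le> 1"
proof -
  have "sublinear (norm :: 'a \<Rightarrow> real)"
    by (auto simp: sublinear_def norm_triangle_ineq)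
  then obtain r :: "'a \<Rightarrow> real" where r: "sublinear r" "\<And>x. r x \<le> norm x" "r (- y) \<le> - norm y"
    using sublinear_lower[of norm y] by metis
  obtain f where f: "linear f" "\<And>x. f x \<le> r x"
    using Hahn_Banach_sublinear[OF r(1)] by metis
  have le: "f x \<le> norm x" for x
    using f(2)[of x] r(2)[of x] by simp
  have bound: "\<bar>f x\<bar> \<le> norm x" for x
    using le[of x] le[of "- x"] linear_neg[OF f(1), of x] by auto
  have bl: "bounded_linear f"
    using bound f(1) by (auto simp: bounded_linear_def bounded_linear_axioms_def intro!: exI[of _ 1])
  have "f y = norm y"
    using f(2)[of "- y"] r(3) le[of y] linear_neg[OF f(1), of y] by simp
  with bl bound show thesis
    by (intro that[of "Blinfun f"] norm_blinfun_bound)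
      (simp_all add: bounded_linear_Blinfun_apply)
qed

section \<open>Transfer of Namioka points\<close>

lemma continuous_map_weak_star_adjoint:
  fixes S :: "'c::real_normed_vector \<Rightarrow>\<^sub>L 'd::real_normed_vector"
  shows "continuous_map weak_star_topology weak_star_topology (\<lambda>w. w o\<^sub>L S)"
  by (simp add: continuous_on_strong_operator_topo_iff_coordinatewise
      strong_operator_topology_continuous_evaluation)

lemma continuous_map_weak_topology_functional:
  "continuous_map weak_topology euclidean (blinfun_apply (f :: 'a::real_normed_vector \<Rightarrow>\<^sub>L real))"
proof -
  have "continuous_map weak_topology euclidean
      ((\<lambda>g. g f) \<circ> (\<lambda>z (f :: 'a \<Rightarrow>\<^sub>L real). blinfun_apply f z))"
    unfolding weak_topology_def
    by (rule continuous_map_pullback) (simp add: continuous_on_product_coordinates)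
  then show ?thesis by (simp add: comp_def)
qed

text \<open>
  Pulling a functional back along a bounded operator gives a bounded functional, so bounded
  operators preserve weak continuity.
\<close>

lemma continuous_map_weak_bounded_linear:
  fixes K :: "'c::real_normed_vector \<Rightarrow> 'd::real_normed_vector"
  assumes "bounded_linear K"
  shows "continuous_map weak_topology weak_topology K"
proof -
  have "continuous_map weak_topology euclidean (\<lambda>z. blinfun_apply f (K z))"
    for f :: "'d \<Rightarrow>\<^sub>L real"
    using continuous_map_weak_topology_functional[of "f o\<^sub>L Blinfun K"]
    by (simp add: bounded_linear_Blinfun_apply[OF assms] blinfun_compose.rep_eq comp_def)
  then have "continuous_map weak_topology (product_topology (\<lambda>_. euclidean) UNIV)
      (\<lambda>z (f :: 'd \<Rightarrow>\<^sub>L real). blinfun_apply f (K z))"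
    by (intro continuous_map_coordinatewise_then_product) auto
  then show ?thesis
    unfolding weak_topology_def[where 'a = 'd]
    by (intro continuous_map_pullback') (auto simp: comp_def euclidean_product_topology)
qed

text \<open>
  The identity on the small unit ball factors through the identity on the large one: the adjoint
  of the contraction \<open>S\<close> goes in, and the adjoint of its right inverse \<open>R\<close> comes back.
\<close>

lemma namioka_point_retract:
  fixes S :: "'c::banach \<Rightarrow>\<^sub>L 'd::banach" and R :: "'d \<Rightarrow>\<^sub>L 'c"
  assumes S: "norm S \<le> 1" and SR: "S o\<^sub>L R = id_blinfun"
    and w: "norm w \<le> 1" and nam: "namioka_point (w o\<^sub>L S)"
  shows "namioka_point w"
  unfolding namioka_point_def topcontinuous_at_def
proof (intro conjI allI impI)
  show "w \<in> topspace (subtopology weak_star_topology (cball 0 1))"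
    using w by (simp add: strong_operator_topology_topspace)
  show "id \<in> topspace (subtopology weak_star_topology (cball 0 1))
      \<rightarrow> topspace (subtopology weak_topology (cball 0 1))"
    by auto
next
  fix V assume V: "openin (subtopology weak_topology (cball 0 1)) V \<and> id w \<in> V"
  then obtain V' where V': "openin weak_topology V'" "V = V' \<inter> cball 0 1"
    by (auto simp: openin_subtopology)
  let ?J = "\<lambda>w. w o\<^sub>L S" and ?K = "\<lambda>u. u o\<^sub>L R"
  have KJ: "?K (?J v) = v" for v :: "'d \<Rightarrow>\<^sub>L real"
  proof (rule blinfun_eqI)
    show "blinfun_apply (?K (?J v)) x = blinfun_apply v x" for x
      using arg_cong[OF SR, of "\<lambda>P. blinfun_apply P x"] by simp
  qed
  have J_ball: "?J v \<in> cball 0 1" if "v \<in> cball 0 1" for v :: "'d \<Rightarrow>\<^sub>L real"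
    using norm_blinfun_compose[of v S] mult_mono[of "norm v" 1 "norm S" 1] S that by simp
  have "bounded_linear ?K"
    by (rule bounded_bilinear.bounded_linear_left[OF bounded_bilinear_blinfun_compose])
  from openin_continuous_map_preimage[OF continuous_map_weak_bounded_linear[OF this] V'(1)]
  have "openin weak_topology {u. ?K u \<in> V'}" by simp
  then have "openin (subtopology weak_topology (cball 0 1)) ({u. ?K u \<in> V'} \<inter> cball 0 1)"
    by (auto simp: openin_subtopology)
  moreover have "?J w \<in> {u. ?K u \<in> V'} \<inter> cball 0 1"
    using V V' KJ J_ball by auto
  ultimately obtain U where U: "openin (subtopology weak_star_topology (cball 0 1)) U"
    "?J w \<in> U" "\<And>u. u \<in> U \<Longrightarrow> ?K u \<in> V'"
    using nam unfolding namioka_point_def topcontinuous_at_def id_apply by (metis IntD1 mem_Collect_eq)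
  then obtain U' where U': "openin weak_star_topology U'" "U = U' \<inter> cball 0 1"
    by (auto simp: openin_subtopology)
  have "openin weak_star_topology {v. ?J v \<in> U'}"
    using openin_continuous_map_preimage[OF continuous_map_weak_star_adjoint U'(1)]
    by (simp add: strong_operator_topology_topspace)
  then have "openin (subtopology weak_star_topology (cball 0 1)) ({v. ?J v \<in> U'} \<inter> cball 0 1)"
    by (auto simp: openin_subtopology)
  moreover have "w \<in> {v. ?J v \<in> U'} \<inter> cball 0 1"
    using U U' w by auto
  moreover have "id v \<in> V" if "v \<in> {v. ?J v \<in> U'} \<inter> cball 0 1" for v
    using that U(3)[of "?J v"] U' V' J_ball KJ by auto
  ultimately show "\<exists>U. openin (subtopology weak_star_topology (cball 0 1)) U \<and> w \<in> U
      \<and> (\<forall>v\<in>U. id v \<in> V)"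
    by blast
qed

section \<open>Factors of an elementary tensor\<close>

lemma norm_bidual_embed_le: "norm (bidual_embed x) \<le> norm x"
proof (rule norm_blinfun_bound)
  show "norm (blinfun_apply (bidual_embed x) f) \<le> norm x * norm f" for f
    using norm_blinfun[of f x] by (simp add: mult.commute)
qed simp

lemma namioka_point_left_factor:
  fixes x0 :: "'a::banach" and y0 :: "'b::banach"
  assumes x0: "norm x0 \<le> 1" and y0: "norm y0 = 1" and nam: "namioka_point (elem_tensor x0 y0)"
  shows "namioka_point (bidual_embed x0)"
proof -
  obtain g :: "'b \<Rightarrow>\<^sub>L real" where g: "blinfun_apply g y0 = 1"
    using norming_functional_exists[of y0] y0 by metis
  define S :: "('a \<Rightarrow>\<^sub>L ('b \<Rightarrow>\<^sub>L real)) \<Rightarrow>\<^sub>L ('a \<Rightarrow>\<^sub>L real)"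
    where "S = Blinfun (\<lambda>T. bidual_embed y0 o\<^sub>L T)"
  \<comment> \<open>\<open>R f\<close> is the rank-one operator taking \<open>x\<close> to the multiple \<open>f x\<close> of \<open>g\<close>.\<close>
  define R :: "('a \<Rightarrow>\<^sub>L real) \<Rightarrow>\<^sub>L ('a \<Rightarrow>\<^sub>L ('b \<Rightarrow>\<^sub>L real))"
    where "R = Blinfun (\<lambda>f. blinfun_scaleR_left g o\<^sub>L f)"
  have S_apply: "blinfun_apply S T = bidual_embed y0 o\<^sub>L T" for T
    unfolding S_def by (simp add: bounded_linear_Blinfun_apply
        bounded_bilinear.bounded_linear_right[OF bounded_bilinear_blinfun_compose])
  have R_apply: "blinfun_apply R f = blinfun_scaleR_left g o\<^sub>L f" for f
    unfolding R_def by (simp add: bounded_linear_Blinfun_apply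
        bounded_bilinear.bounded_linear_right[OF bounded_bilinear_blinfun_compose])
  show ?thesis
  proof (rule namioka_point_retract)
    show "norm S \<le> 1"
    proof (rule norm_blinfun_bound)
      fix T :: "'a \<Rightarrow>\<^sub>L ('b \<Rightarrow>\<^sub>L real)"
      have "norm (bidual_embed y0 o\<^sub>L T) \<le> norm (bidual_embed y0) * norm T"
        by (rule norm_blinfun_compose)
      also have "\<dots> \<le> 1 * norm T"
        using norm_bidual_embed_le[of y0] y0 by (intro mult_right_mono) auto
      finally show "norm (blinfun_apply S T) \<le> 1 * norm T" by (simp add: S_apply)
    qed simp
    show "S o\<^sub>L R = id_blinfun"
      by (rule blinfun_eqI)+ (simp add: S_apply R_apply blinfun.scaleR_left g)
    show "norm (bidual_embed x0) \<le> 1"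
      using norm_bidual_embed_le[of x0] x0 by simp
    have "bidual_embed x0 o\<^sub>L S = elem_tensor x0 y0"
      by (rule blinfun_eqI) (simp add: S_apply)
    with nam show "namioka_point (bidual_embed x0 o\<^sub>L S)" by simp
  qed
qed

lemma namioka_point_right_factor:
  fixes x0 :: "'a::banach" and y0 :: "'b::banach"
  assumes x0: "norm x0 = 1" and y0: "norm y0 \<le> 1" and nam: "namioka_point (elem_tensor x0 y0)"
  shows "namioka_point (bidual_embed y0)"
proof -
  obtain f :: "'a \<Rightarrow>\<^sub>L real" where f: "blinfun_apply f x0 = 1"
    using norming_functional_exists[of x0] x0 by metis
  define S :: "('a \<Rightarrow>\<^sub>L ('b \<Rightarrow>\<^sub>L real)) \<Rightarrow>\<^sub>L ('b \<Rightarrow>\<^sub>L real)"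
    where "S = Blinfun (\<lambda>T. blinfun_apply T x0)"
  \<comment> \<open>\<open>R g\<close> is the rank-one operator taking \<open>x\<close> to the multiple \<open>f x\<close> of \<open>g\<close>.\<close>
  define R :: "('b \<Rightarrow>\<^sub>L real) \<Rightarrow>\<^sub>L ('a \<Rightarrow>\<^sub>L ('b \<Rightarrow>\<^sub>L real))"
    where "R = Blinfun (\<lambda>g. blinfun_scaleR_left g o\<^sub>L f)"
  have S_apply: "blinfun_apply S T = blinfun_apply T x0" for T
    unfolding S_def by (simp add: bounded_linear_Blinfun_apply)
  have "bounded_linear (\<lambda>g :: 'b \<Rightarrow>\<^sub>L real. blinfun_scaleR_left g o\<^sub>L f)"
    by (rule bounded_linear_compose[OF
          bounded_bilinear.bounded_linear_left[OF bounded_bilinear_blinfun_compose]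
          bounded_linear_blinfun_scaleR_left])
  then have R_apply: "blinfun_apply R g = blinfun_scaleR_left g o\<^sub>L f" for g
    unfolding R_def by (simp add: bounded_linear_Blinfun_apply)
  show ?thesis
  proof (rule namioka_point_retract)
    show "norm S \<le> 1"
    proof (rule norm_blinfun_bound)
      fix T :: "'a \<Rightarrow>\<^sub>L ('b \<Rightarrow>\<^sub>L real)"
      show "norm (blinfun_apply S T) \<le> 1 * norm T"
        using norm_blinfun[of T x0] x0 by (simp add: S_apply)
    qed simp
    show "S o\<^sub>L R = id_blinfun"
      by (rule blinfun_eqI)+ (simp add: S_apply R_apply f)
    show "norm (bidual_embed y0) \<le> 1"
      using norm_bidual_embed_le[of y0] y0 by simp
    have "bidual_embed y0 o\<^sub>L S = elem_tensor x0 y0"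
      by (rule blinfun_eqI) (simp add: S_apply)
    with nam show "namioka_point (bidual_embed y0 o\<^sub>L S)" by simp
  qed
qed

theorem theorem3p1:
  fixes x0 :: "'a::banach" and y0 :: "'b::banach"
  assumes "x0 \<in> sphere 0 1" and "y0 \<in> sphere 0 1"
    and "namioka_point (elem_tensor x0 y0)"
  shows "namioka_point (bidual_embed x0) \<and> namioka_point (bidual_embed y0)"
  using assms namioka_point_left_factor[of x0 y0] namioka_point_right_factor[of x0 y0] by simp

end
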